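(* Let $n\ge 1$. Every vertex $w\in F_n$ of the Hurwitz graph $\mathcal{H}(S_n)$ such that $\Gamma(w)$ is a boundary caterpillar is a central vertex of $\mathcal{H}(S_n)$.
   Context: $F_n$ is the set of all words $(t_1,\dots,t_{n-1})$ of $n-1$ transpositions in the symmetric group $S_n$ whose product $t_1\cdots t_{n-1}$ equals the $n$-cycle $c=(1,2,\dots,n)$ (these correspond bijectively to maximal chains in the non-crossing partition lattice). Permutations are multiplied as functions, right to left. With $g^h:=h^{-1}gh$, for $1\le i\le n-2$ and $v=(t_1,\dots,t_{n-1})\in F_n$ the right and left Hurwitz actions are $R_i(v)=(t_1,\dots,t_{i-1},t_{i+1}^{t_i},t_i,t_{i+2},\dots,t_{n-1})$ and $L_i(v)=(t_1,\dots,t_{i-1},t_{i+1},t_i^{t_{i+1}},t_{i+2},\dots,t_{n-1})$. The Hurwitz graph $\mathcal{H}(S_n)$ has vertex set $F_n$, and two vertices are adjacent if one is obtained from the other by applying some $R_i$ or $L_i$. A central vertex of a connected finite graph is a vertex whose eccentricity (maximum distance to another vertex) equals the radius (the minimum eccentricity). For a word $w=((a_1\ b_1),\dots,(a_k\ b_k))$ of transpositions in $S_n$, $\Gamma(w)$ is the geometric graph with vertices $1,\dots,n$ drawn clockwise on a circle and edges the straight segments joining $a_i$ and $b_i$, $1\le i\le k$. A non-crossing geometric tree is such a graph that is a tree and in which any two edges intersect only in a common vertex (if at all). A boundary caterpillar is a non-crossing geometric tree on $\{1,\dots,n\}$ which is a caterpillar (deleting all leaves leaves a path, the spine) and whose spine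 is either a single vertex or a path with edges $(i\ i+1),(i+1\ i+2),\dots,(i+k-1\ i+k)$, labels taken modulo $n$. Trees with at most two vertices are regarded as boundary caterpillars. *)

theory Defs
  imports "HOL-Analysis.Analysis" "HOL-Library.Extended_Nat" "HOL-Combinatorics.Cycles"
begin

(* A graph is given by a vertex set V and a set E of unordered pairs {u, v} of vertices. *)

definition graph_adj :: "'a set set \<Rightarrow> ('a \<times> 'a) set" where
  "graph_adj E = {(u, v). {u, v} \<in> E}"

definition graph_connected :: "'a set \<Rightarrow> 'a set set \<Rightarrow> bool" where
  "graph_connected V E \<longleftrightarrow> V \<noteq> {} \<and> (\<forall>u\<in>V. \<forall>v\<in>V. (u, v) \<in> (graph_adj E)\<^sup>*)"

(* The relational power (graph_adj E) ^^ k relates the endpoints of walks with k edges;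
   the distance is infinite if there is no walk. *)
definition graph_dist :: "'a set set \<Rightarrow> 'a \<Rightarrow> 'a \<Rightarrow> enat" where
  "graph_dist E u v = (INF k\<in>{k. (u, v) \<in> graph_adj E ^^ k}. enat k)"

definition eccentricity :: "'a set \<Rightarrow> 'a set set \<Rightarrow> 'a \<Rightarrow> enat" where
  "eccentricity V E v = (SUP u\<in>V. graph_dist E v u)"

definition graph_radius :: "'a set \<Rightarrow> 'a set set \<Rightarrow> enat" where
  "graph_radius V E = (INF v\<in>V. eccentricity V E v)"

(* Central vertices are a notion for connected finite graphs only. Without these two
   conjuncts, every vertex of a disconnected graph would be central (infinity = infinity). *)
definition central_vertex :: "'a set \<Rightarrow> 'a set set \<Rightarrow> 'a \<Rightarrow> bool" where
  "central_vertex V E v \<longleftrightarrow>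
     finite V \<and> graph_connected V E \<and> v \<in> V \<and> eccentricity V E v = graph_radius V E"

definition graph_cycle :: "'a set set \<Rightarrow> 'a list \<Rightarrow> bool" where
  "graph_cycle E xs \<longleftrightarrow> 3 \<le> length xs \<and> distinct xs \<and>
     (\<forall>i<length xs. {xs ! i, xs ! (Suc i mod length xs)} \<in> E)"

definition graph_tree :: "'a set \<Rightarrow> 'a set set \<Rightarrow> bool" where
  "graph_tree V E \<longleftrightarrow> graph_connected V E \<and> (\<nexists>xs. graph_cycle E xs)"

(* (V, E) is the path visiting exactly the vertices xs, in this order;
   a one-element list gives the single-vertex path. *)
definition is_path_graph :: "'a set \<Rightarrow> 'a set set \<Rightarrow> 'a list \<Rightarrow> bool" where
  "is_path_graph V E xs \<longleftrightarrow> xs \<noteq> [] \<and> distinct xs \<and> set xs = V \<and>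
     E = {{xs ! i, xs ! Suc i} | i. Suc i < length xs}"

definition leaves :: "'a set \<Rightarrow> 'a set set \<Rightarrow> 'a set" where
  "leaves V E = {v \<in> V. card {e \<in> E. v \<in> e} = 1}"

(* What is left of a graph after deleting all its leaves. *)
definition spine_verts :: "'a set \<Rightarrow> 'a set set \<Rightarrow> 'a set" where
  "spine_verts V E = V - leaves V E"

definition spine_edges :: "'a set \<Rightarrow> 'a set set \<Rightarrow> 'a set set" where
  "spine_edges V E = {e \<in> E. e \<subseteq> spine_verts V E}"

definition caterpillar :: "'a set \<Rightarrow> 'a set set \<Rightarrow> bool" where
  "caterpillar V E \<longleftrightarrow> graph_tree V E \<and>
     (\<exists>xs. is_path_graph (spine_verts V E) (spine_edges V E) xs)"

(* Clockwise placement of the vertices 1, ..., n on the unit circle. *)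
definition circle_point :: "nat \<Rightarrow> nat \<Rightarrow> complex" where
  "circle_point n j = cis (- (2 * pi * real j / real n))"

definition geometric_noncrossing :: "nat \<Rightarrow> nat set set \<Rightarrow> bool" where
  "geometric_noncrossing n E \<longleftrightarrow>
     (\<forall>a b c d. {a, b} \<in> E \<and> {c, d} \<in> E \<and> {a, b} \<noteq> {c, d} \<longrightarrow>
        closed_segment (circle_point n a) (circle_point n b) \<inter>
        closed_segment (circle_point n c) (circle_point n d)
        \<subseteq> circle_point n ` ({a, b} \<inter> {c, d}))"

definition noncrossing_tree :: "nat \<Rightarrow> nat set set \<Rightarrow> bool" where
  "noncrossing_tree n E \<longleftrightarrow> graph_tree {1..n} E \<and> geometric_noncrossing n E"

(* The representative of m modulo n among the labels 1, ..., n. *)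
definition label_mod :: "nat \<Rightarrow> nat \<Rightarrow> nat" where
  "label_mod n m = (if m mod n = 0 then n else m mod n)"

(* k = 0 is the case of a single-vertex spine. For n = 2 the spine is empty, so trees with
   at most two vertices are admitted separately. *)
definition boundary_caterpillar :: "nat \<Rightarrow> nat set set \<Rightarrow> bool" where
  "boundary_caterpillar n E \<longleftrightarrow> noncrossing_tree n E \<and>
     (n \<le> 2 \<or>
      caterpillar {1..n} E \<and>
      (\<exists>i\<in>{1..n}. \<exists>k. is_path_graph (spine_verts {1..n} E) (spine_edges {1..n} E)
                         (map (\<lambda>j. label_mod n (i + j)) [0..<Suc k])))"

(* Elements of S_n are functions on nat that fix everything outside {1..n}. Words are lists;
   products are compositions of functions, so the rightmost factor acts first. *)

definition transpositions :: "nat \<Rightarrow> (nat \<Rightarrow> nat) set" where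
  "transpositions n = {Transposition.transpose a b | a b. a \<in> {1..n} \<and> b \<in> {1..n} \<and> a \<noteq> b}"

definition word_prod :: "(nat \<Rightarrow> nat) list \<Rightarrow> nat \<Rightarrow> nat" where
  "word_prod w = foldr (\<circ>) w id"

(* cycle_of_list [1, ..., n] maps j to j + 1 for j < n, and n to 1. *)
definition factorizations :: "nat \<Rightarrow> (nat \<Rightarrow> nat) list set" where
  "factorizations n =
     {w. length w = n - 1 \<and> set w \<subseteq> transpositions n \<and> word_prod w = cycle_of_list [1..<Suc n]}"

definition perm_conj :: "(nat \<Rightarrow> nat) \<Rightarrow> (nat \<Rightarrow> nat) \<Rightarrow> nat \<Rightarrow> nat" where
  "perm_conj g h = inv h \<circ> g \<circ> h"

(* The letter t_i of the word v = (t_1, t_2, ...) is v ! (i - 1). *)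
definition hurwitz_R :: "nat \<Rightarrow> (nat \<Rightarrow> nat) list \<Rightarrow> (nat \<Rightarrow> nat) list" where
  "hurwitz_R i v = v[i - 1 := perm_conj (v ! i) (v ! (i - 1)), i := v ! (i - 1)]"

definition hurwitz_L :: "nat \<Rightarrow> (nat \<Rightarrow> nat) list \<Rightarrow> (nat \<Rightarrow> nat) list" where
  "hurwitz_L i v = v[i - 1 := v ! i, i := perm_conj (v ! (i - 1)) (v ! i)]"

definition hurwitz_edges :: "nat \<Rightarrow> (nat \<Rightarrow> nat) list set set" where
  "hurwitz_edges n = {{u, v} | u v. u \<in> factorizations n \<and> v \<in> factorizations n \<and>
     (\<exists>i\<in>{1..n - 2}. v = hurwitz_R i u \<or> v = hurwitz_L i u)}"

(* The graph drawn from a word w; its vertex set is {1..n}. *)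
definition word_edges :: "(nat \<Rightarrow> nat) list \<Rightarrow> nat set set" where
  "word_edges w = {{a, b} | a b. a \<noteq> b \<and> Transposition.transpose a b \<in> set w}"

end

theory Submission
  imports Defs
begin

text \<open>
  The radius of the Hurwitz graph is \<open>n - 1 choose 2\<close>: every vertex has a vertex at least that
  far away, and a boundary caterpillar has no vertex farther away.

  Lower bound. A word of transpositions is a sequence of edges, and the closure \<open>cl\<close> of a set of
  edges under connectivity is the closure operator of a matroid. Fix a second word with prefixes
  \<open>G 0 \<subseteq> G 1 \<subseteq> \<dots>\<close>. For each letter of \<open>w\<close>, record for how many \<open>j\<close> the letter still joins
  two components after the earlier letters of \<open>w\<close> and \<open>G j\<close> have been inserted
  (\<open>thresholds\<close>). This is the Jordan-Hoelder comparison of two flags. A Hurwitz move replaces two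
  adjacent letters by two letters with the same span, so by the exchange property it either fixes the
  two thresholds or swaps them (\<open>thresholds_local_change\<close>), and the number of inversions of the
  threshold sequence changes by at most one. Now compare with the half twist of \<open>w\<close>, whose first
  \<open>j\<close> letters span the same as the last \<open>j\<close> letters of \<open>w\<close>: the thresholds of \<open>w\<close> decrease strictly,
  those of its half twist increase strictly. Here it matters that factorizations are
  independent: their \<open>n - 1\<close> letters connect \<open>n\<close> points.

  Upper bound. Let \<open>x\<close> be a word in which every letter moves a point fixed by all
  earlier letters (\<open>growing\<close>), and let \<open>y\<close> be another minimal word with the same product \<open>p\<close>.
  Let \<open>v\<close> be the new point of the last letter of \<open>x\<close>. Push the first letter of \<open>y\<close> that moves \<open>v\<close>
  to the right end, one move per letter, so that the letters it passes end up fixing \<open>v\<close>. The final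
  letter then has to exchange \<open>v\<close> with the preimage of \<open>v\<close> under \<open>p\<close>, exactly like the last
  letter of \<open>x\<close>. Cancel it and recurse: \<open>y\<close> reaches \<open>x\<close> in at most
  \<open>(m - 1) + (m - 2) + \<dots> + 1\<close> moves, where \<open>m\<close> is the length.

  Boundary caterpillars are growing. If both ends of a letter were moved before, neither end is a leaf,
  so the letter is a spine edge and joins some \<open>q\<close> to its successor \<open>c q\<close> on the circle.
  Following \<open>q\<close> through the product traces a walk in the tree from \<open>q\<close> to \<open>c q\<close>; it consists of
  this edge alone, which forces the edge to come before all other edges at \<open>c q\<close>
  (\<open>successor_edge_comes_first\<close>). This contradicts the assumption that \<open>c q\<close> was moved before.
\<close>

section \<open>Transpositions\<close>

definition is_transp :: "('a \<Rightarrow> 'a) \<Rightarrow> bool" where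
  "is_transp t \<longleftrightarrow> (\<exists>a b. a \<noteq> b \<and> t = Transposition.transpose a b)"

lemma is_transp_involution: "is_transp t \<Longrightarrow> t (t x) = x"
  by (auto simp: is_transp_def)

lemma is_transp_comp_self: "is_transp t \<Longrightarrow> t \<circ> t = id"
  by (auto simp: is_transp_def)

lemma is_transp_bij: "is_transp t \<Longrightarrow> bij t"
  by (auto simp: is_transp_def)

lemma is_transp_inv: "is_transp t \<Longrightarrow> inv t = t"
  by (auto simp: is_transp_def)

lemma is_transp_moving:
  assumes "is_transp t" "t v \<noteq> v"
  shows "t = Transposition.transpose (t v) v"
proof -
  obtain a b where t: "t = Transposition.transpose a b" using assms(1) by (auto simp: is_transp_def)
  then consider "v = a" | "v = b" using assms(2) by (metis transpose_apply_other)
  then show ?thesis using t by cases (auto simp: transpose_commute)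
qed

lemma perm_conj_transpose:
  "bij p \<Longrightarrow> perm_conj (Transposition.transpose a b) p = Transposition.transpose (inv p a) (inv p b)"
  unfolding perm_conj_def
  by (auto simp: fun_eq_iff Transposition.transpose_def bij_inv_eq_iff bij_is_inj)

lemma is_transp_perm_conj: "is_transp t \<Longrightarrow> bij p \<Longrightarrow> is_transp (perm_conj t p)"
proof -
  assume "is_transp t" and p: "bij p"
  then obtain a b where t: "a \<noteq> b" "t = Transposition.transpose a b" by (auto simp: is_transp_def)
  then have "inv p a \<noteq> inv p b" using bij_inv_eq_iff[OF p] by metis
  then show "is_transp (perm_conj t p)"
    using t perm_conj_transpose[OF p] by (auto simp: is_transp_def)
qed

section \<open>The connectivity closure\<close>

text \<open>
  For a set of transpositions, read as edges, \<open>reach\<close> is connectivity in the graph. Generating it from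
  arbitrary functions lets products and conjugates take part in closure arguments.
\<close>

definition reach :: "('a \<Rightarrow> 'a) set \<Rightarrow> ('a \<times> 'a) set" where
  "reach F = {(x, f x) |x f. f \<in> F}\<^sup>*"

definition cl :: "('a \<Rightarrow> 'a) set \<Rightarrow> ('a \<Rightarrow> 'a) set" where
  "cl F = {t. \<forall>x. (x, t x) \<in> reach F}"

lemma reach_refl [simp]: "(x, x) \<in> reach F"
  by (simp add: reach_def)

lemma reach_trans: "(x, y) \<in> reach F \<Longrightarrow> (y, z) \<in> reach F \<Longrightarrow> (x, z) \<in> reach F"
  unfolding reach_def by (rule rtrancl_trans)

lemma reach_gen: "f \<in> F \<Longrightarrow> (x, f x) \<in> reach F"
  unfolding reach_def by (rule r_into_rtrancl) blast

lemma reach_mono: "F \<subseteq> G \<Longrightarrow> reach F \<subseteq> reach G"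
  unfolding reach_def by (rule rtrancl_mono) blast

lemma reach_sym:
  assumes "\<forall>f\<in>F. is_transp f" "(x, y) \<in> reach F"
  shows "(y, x) \<in> reach F"
proof -
  have "(f x, x) \<in> {(x, f x) |x f. f \<in> F}" if "f \<in> F" for f x
  proof -
    have "x = f (f x)" using that is_transp_involution assms(1) by metis
    then show ?thesis using that by blast
  qed
  then have "sym {(x, f x) |x f. f \<in> F}"
    by (auto intro!: symI)
  then show ?thesis
    using sym_rtrancl symD assms(2) unfolding reach_def by fast
qed

lemma cl_extensive: "F \<subseteq> cl F"
  by (auto simp: cl_def reach_gen)

lemma cl_mono: "F \<subseteq> G \<Longrightarrow> cl F \<subseteq> cl G"
  using reach_mono unfolding cl_def by blast

lemma cl_least:
  assumes "F \<subseteq> cl G"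
  shows "reach F \<subseteq> reach G"
proof -
  have "{(x, f x) |x f. f \<in> F} \<subseteq> reach G" using assms unfolding cl_def by blast
  then have "reach F \<subseteq> (reach G)\<^sup>*" unfolding reach_def[of F] by (rule rtrancl_mono)
  then show ?thesis by (simp add: reach_def)
qed

lemma cl_subset: "F \<subseteq> cl G \<Longrightarrow> cl F \<subseteq> cl G"
  using cl_least[of F G] by (auto simp: cl_def)

lemma cl_eq: "F \<subseteq> cl G \<Longrightarrow> G \<subseteq> cl F \<Longrightarrow> cl F = cl G"
  by (simp add: cl_subset subset_antisym)

lemma cl_Un_cong:
  assumes "cl F = cl G"
  shows "cl (F \<union> H) = cl (G \<union> H)"
proof -
  have "F' \<union> H \<subseteq> cl (G' \<union> H)" if "cl F' = cl G'" for F' G'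
    using cl_extensive[of F'] cl_extensive[of "G' \<union> H"] cl_mono[of G' "G' \<union> H"] that by auto
  then show ?thesis using assms by (intro cl_eq) auto
qed

lemma cl_insert_absorb:
  assumes "t \<in> cl F"
  shows "cl (insert t F) = cl F"
  using assms cl_extensive[of F] cl_mono[of F "insert t F"] by (intro cl_eq) auto

lemma cl_comp: "f \<in> cl F \<Longrightarrow> g \<in> cl F \<Longrightarrow> f \<circ> g \<in> cl F"
  by (auto simp: cl_def intro: reach_trans)

lemma word_prod_simps [simp]:
  "word_prod [] = id" "word_prod (t # w) = t \<circ> word_prod w"
  by (simp_all add: word_prod_def)

lemma word_prod_in_cl: "word_prod w \<in> cl (set w)"
proof (induction w)
  case Nil
  then show ?case by (simp add: cl_def)
next
  case (Cons t w)
  have "t \<in> cl (set (t # w))" "word_prod w \<in> cl (set (t # w))"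
    using cl_extensive[of "set (t # w)"] Cons cl_mono[of "set w" "set (t # w)"] by auto
  then show ?case unfolding word_prod_simps by (rule cl_comp)
qed

lemma reach_insert_transpose:
  "(x, y) \<in> reach (insert (Transposition.transpose a b) F) \<longleftrightarrow>
    (x, y) \<in> reach F \<or> (x, a) \<in> reach F \<and> (b, y) \<in> reach F
      \<or> (x, b) \<in> reach F \<and> (a, y) \<in> reach F" (is "?L \<longleftrightarrow> ?R y")
proof
  let ?t = "Transposition.transpose a b"
  assume ?L
  then show "?R y" unfolding reach_def[of "insert _ _"]
  proof (induction rule: rtrancl_induct)
    case base
    then show ?case by simp
  next
    case (step y z)
    then consider f where "f \<in> F" "z = f y" | "z = ?t y" by auto
    then show ?case
    proof cases
      case 1
      then show ?thesis using step.IH reach_gen reach_trans by metis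
    next
      case 2
      then show ?thesis using step.IH by (auto simp: Transposition.transpose_def split: if_splits)
    qed
  qed
next
  let ?G = "insert (Transposition.transpose a b) F"
  have "(a, b) \<in> reach ?G" "(b, a) \<in> reach ?G"
    using reach_gen[of "Transposition.transpose a b" ?G] by (metis insertI1 transpose_apply_first transpose_apply_second)+
  moreover have "reach F \<subseteq> reach ?G" by (rule reach_mono) auto
  ultimately show "?R y \<Longrightarrow> ?L" by (meson reach_trans subsetD)
qed

text \<open>
  An edge lies in the closure iff its ends are already connected, so \<open>cl\<close> restricted to transpositions
  is the closure operator of the graphic matroid.
\<close>

lemma transpose_in_cl_iff:
  assumes "\<forall>f\<in>F. is_transp f"
  shows "Transposition.transpose a b \<in> cl F \<longleftrightarrow> (a, b) \<in> reach F"
proof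
  assume "Transposition.transpose a b \<in> cl F"
  then have "(a, Transposition.transpose a b a) \<in> reach F" unfolding cl_def by blast
  then show "(a, b) \<in> reach F" by simp
next
  assume "(a, b) \<in> reach F"
  then show "Transposition.transpose a b \<in> cl F"
    using reach_sym[OF assms] by (auto simp: cl_def Transposition.transpose_def)
qed

text \<open>
  The exchange property: a path from \<open>a\<close> to \<open>b\<close> that needs the edge \<open>e\<close> can be cut at \<open>e\<close> and closed up
  with \<open>p\<close> to a path between the ends of \<open>e\<close>.
\<close>

lemma cl_exchange:
  assumes F: "\<forall>f\<in>F. is_transp f" and "is_transp p" "is_transp e"
    and "p \<in> cl (insert e F)" "p \<notin> cl F"
  shows "e \<in> cl (insert p F)"
proof -
  obtain a b c d where p: "p = Transposition.transpose a b" and e: "e = Transposition.transpose c d"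
    using assms(2,3) unfolding is_transp_def by blast
  have "(a, b) \<in> reach (insert e F)" "(a, b) \<notin> reach F"
    using assms transpose_in_cl_iff[of F a b] transpose_in_cl_iff[of "insert e F" a b] p by auto
  then have "(a, c) \<in> reach F \<and> (d, b) \<in> reach F \<or> (a, d) \<in> reach F \<and> (c, b) \<in> reach F"
    unfolding e reach_insert_transpose by auto
  then have "(c, d) \<in> reach (insert p F)"
    unfolding p reach_insert_transpose using reach_sym[OF F] by blast
  then show ?thesis
    using assms(2) F transpose_in_cl_iff[of "insert p F" c d] e by auto
qed

text \<open>
  Each new edge merges at most two components, so at most one representative has to be given up
  per letter. A set of representatives is easier to maintain than the quotient itself.
\<close>

lemma separated_set_exists:
  assumes "\<forall>t\<in>set w. is_transp t" "finite V"
  shows "\<exists>T\<subseteq>V. card V \<le> card T + length w \<and> (\<forall>u\<in>T. \<forall>v\<in>T. (u, v) \<in> reach (set w) \<longrightarrow> u = v)"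
  using assms(1)
proof (induction w)
  case Nil
  have "reach {} = Id" by (simp add: reach_def)
  then show ?case by auto
next
  case (Cons t w)
  then obtain T where T: "T \<subseteq> V" "card V \<le> card T + length w"
    "\<forall>u\<in>T. \<forall>v\<in>T. (u, v) \<in> reach (set w) \<longrightarrow> u = v" by auto
  obtain a b where t: "t = Transposition.transpose a b"
    using Cons.prems by (auto simp: is_transp_def)
  have sym: "(y, x) \<in> reach (set w)" if "(x, y) \<in> reach (set w)" for x y
    using reach_sym that Cons.prems by (metis list.set_intros(2))
  \<comment> \<open>every newly connected pair of representatives has one member connected to \<open>a\<close>\<close>
  define D where "D = {u \<in> T. (u, a) \<in> reach (set w)}"
  have "finite T" using T(1) assms(2) finite_subset by auto
  have "card D \<le> 1"
  proof -
    have "\<forall>u\<in>D. \<forall>v\<in>D. u = v"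
      using T(3) sym unfolding D_def by (blast intro: reach_trans)
    then show ?thesis by (metis card_le_Suc0_iff_eq card.infinite One_nat_def le0)
  qed
  then have "card T \<le> card (T - D) + 1"
    using card_Diff_subset[of D T] \<open>finite T\<close> D_def by fastforce
  moreover have "\<forall>u\<in>T-D. \<forall>v\<in>T-D. (u, v) \<in> reach (set (t # w)) \<longrightarrow> u = v"
    using T(3) sym unfolding t list.set reach_insert_transpose D_def by blast
  ultimately show ?case using T by (intro exI[of _ "T - D"]) auto
qed

lemma connecting_word_length:
  assumes "\<forall>t\<in>set w. is_transp t" "finite V" "\<forall>u\<in>V. \<forall>v\<in>V. (u, v) \<in> reach (set w)"
  shows "card V \<le> length w + 1"
proof -
  obtain T where T: "T \<subseteq> V" "card V \<le> card T + length w"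
    "\<forall>u\<in>T. \<forall>v\<in>T. (u, v) \<in> reach (set w) \<longrightarrow> u = v"
    using separated_set_exists[OF assms(1,2)] by blast
  then have "\<forall>u\<in>T. \<forall>v\<in>T. u = v" using assms(3) by blast
  then have "card T \<le> 1" by (metis card_le_Suc0_iff_eq card.infinite One_nat_def le0)
  then show ?thesis using T by simp
qed

lemma word_prod_append [simp]: "word_prod (u @ w) = word_prod u \<circ> word_prod w"
  by (induction u) (auto simp: comp_assoc)

lemma word_prod_bij: "\<forall>t\<in>set w. is_transp t \<Longrightarrow> bij (word_prod w)"
  by (induction w) (auto simp: is_transp_bij bij_comp)

lemma word_prod_fixes: "\<forall>t\<in>set w. t v = v \<Longrightarrow> word_prod w v = v"
  by (induction w) auto

section \<open>Hurwitz moves and minimal words\<close>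

text \<open>
  No restriction to factorizations of the long cycle: cutting off the last letter of such a factorization leaves
  a factorization of another permutation, to which moves must still apply.
\<close>

definition hurwitz_moves :: "((nat \<Rightarrow> nat) list \<times> (nat \<Rightarrow> nat) list) set" where
  "hurwitz_moves = {(A @ p # q # B, A @ p' # q' # B) | A B p q p' q'.
     p' = perm_conj q p \<and> q' = p \<or> p' = q \<and> q' = perm_conj p q}"

lemma hurwitz_movesI:
  "p' = perm_conj q p \<and> q' = p \<or> p' = q \<and> q' = perm_conj p q
    \<Longrightarrow> (A @ p # q # B, A @ p' # q' # B) \<in> hurwitz_moves"
  unfolding hurwitz_moves_def by blast

lemma hurwitz_moves_append:
  assumes "(u, v) \<in> hurwitz_moves"
  shows "(A @ u @ B, A @ v @ B) \<in> hurwitz_moves"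
proof -
  obtain C D p q p' q' where *: "u = C @ p # q # D" "v = C @ p' # q' # D"
    "p' = perm_conj q p \<and> q' = p \<or> p' = q \<and> q' = perm_conj p q"
    using assms unfolding hurwitz_moves_def by blast
  show ?thesis unfolding hurwitz_moves_def mem_Collect_eq
    by (rule exI[of _ "A @ C"], rule exI[of _ "D @ B"],
        rule exI[of _ p], rule exI[of _ q], rule exI[of _ p'], rule exI[of _ q']) (use * in auto)
qed

lemma hurwitz_moves_pow_append:
  "(u, v) \<in> hurwitz_moves ^^ k \<Longrightarrow> (A @ u @ B, A @ v @ B) \<in> hurwitz_moves ^^ k"
proof (induction k arbitrary: v)
  case (Suc k)
  then show ?case using hurwitz_moves_append by (metis relpow_Suc_E relpow_Suc_I)
qed auto

lemma hurwitz_moves_invariants: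
  assumes "(u, v) \<in> hurwitz_moves" "\<forall>t\<in>set u. is_transp t"
  shows "length v = length u" "word_prod v = word_prod u" "\<forall>t\<in>set v. is_transp t"
proof -
  obtain A B p q p' q' where u: "u = A @ p # q # B" and v: "v = A @ p' # q' # B" and
    m: "p' = perm_conj q p \<and> q' = p \<or> p' = q \<and> q' = perm_conj p q"
    using assms(1) unfolding hurwitz_moves_def by blast
  have pq: "is_transp p" "is_transp q" using assms(2) u by auto
  have "p' \<circ> q' = p \<circ> q"
    using m is_transp_inv is_transp_involution pq unfolding perm_conj_def by fastforce
  then show "word_prod v = word_prod u" unfolding u v by (simp add: comp_assoc[symmetric])
  have "is_transp p'" "is_transp q'"
    using m pq is_transp_perm_conj is_transp_bij by auto
  then show "\<forall>t\<in>set v. is_transp t" using assms(2) unfolding u v by auto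
  show "length v = length u" unfolding u v by simp
qed

lemma hurwitz_moves_pow_invariants:
  assumes "(u, v) \<in> hurwitz_moves ^^ k" "\<forall>t\<in>set u. is_transp t"
  shows "length v = length u \<and> word_prod v = word_prod u \<and> (\<forall>t\<in>set v. is_transp t)"
  using assms
proof (induction k arbitrary: v)
  case (Suc k)
  then show ?case using hurwitz_moves_invariants by (metis relpow_Suc_E)
qed auto

text \<open>
  These are the reduced words with respect to the generating set of all transpositions.
\<close>

definition minimal_word :: "(nat \<Rightarrow> nat) list \<Rightarrow> bool" where
  "minimal_word w \<longleftrightarrow> (\<forall>t\<in>set w. is_transp t) \<and>
    (\<forall>z. (\<forall>t\<in>set z. is_transp t) \<longrightarrow> word_prod z = word_prod w \<longrightarrow> length w \<le> length z)"

lemma minimal_word_transp: "minimal_word w \<Longrightarrow> t \<in> set w \<Longrightarrow> is_transp t"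
  unfolding minimal_word_def by blast

lemma minimal_word_factor:
  assumes "minimal_word (A @ w @ B)"
  shows "minimal_word w"
  unfolding minimal_word_def
proof (intro conjI allI impI)
  show "\<forall>t\<in>set w. is_transp t" using assms by (auto simp: minimal_word_def)
next
  fix z :: "(nat \<Rightarrow> nat) list"
  assume "\<forall>t\<in>set z. is_transp t" "word_prod z = word_prod w"
  then have "\<forall>t\<in>set (A @ z @ B). is_transp t" "word_prod (A @ z @ B) = word_prod (A @ w @ B)"
    using assms by (auto simp: minimal_word_def)
  then have "length (A @ w @ B) \<le> length (A @ z @ B)" using assms unfolding minimal_word_def by blast
  then show "length w \<le> length z" by simp
qed

lemma minimal_word_hurwitz_moves:
  assumes "minimal_word u" "(u, v) \<in> hurwitz_moves ^^ k"
  shows "minimal_word v"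
  using assms hurwitz_moves_pow_invariants[OF assms(2)] unfolding minimal_word_def by auto

lemma minimal_word_adjacent_distinct:
  assumes "minimal_word (t # q # w)"
  shows "t \<noteq> q"
proof
  assume "t = q"
  then have "word_prod w = word_prod (t # q # w)"
    using assms is_transp_comp_self[of q] unfolding minimal_word_def by (simp add: comp_assoc[symmetric])
  then have "length (t # q # w) \<le> length w" using assms unfolding minimal_word_def by simp
  then show False by simp
qed

section \<open>Reaching a growing word\<close>

text \<open>
  Let \<open>t\<close> pass its right neighbour \<open>q\<close>. If \<open>q\<close> fixes \<open>v\<close>, the left action conjugates \<open>t\<close>, which
  still moves \<open>v\<close>. If \<open>q\<close> moves \<open>v\<close>, the right action conjugates \<open>q\<close> by \<open>t\<close>; with \<open>t\<close> exchanging
  \<open>a\<close> and \<open>v\<close>, and \<open>q\<close> exchanging \<open>b\<close> and \<open>v\<close>, the conjugate exchanges \<open>a\<close> and \<open>b\<close>. Minimality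
  enters through \<open>a \<noteq> b\<close>.
\<close>

lemma push_right:
  assumes "minimal_word (t # w)" "t v \<noteq> v"
  shows "\<exists>w' t'. (t # w, w' @ [t']) \<in> hurwitz_moves ^^ length w \<and> t' v \<noteq> v \<and> (\<forall>s\<in>set w'. s v = v)"
  using assms
proof (induction w arbitrary: t)
  case Nil
  then have "([t], [] @ [t]) \<in> hurwitz_moves ^^ length []" by simp
  then show ?case using Nil.prems(2) by (metis empty_iff empty_set)
next
  case (Cons q w)
  have tq: "is_transp t" "is_transp q" and ne: "t \<noteq> q"
    using minimal_word_transp[OF Cons.prems(1)] minimal_word_adjacent_distinct[OF Cons.prems(1)] by auto
  have "\<exists>p' t'. (t # q # w, p' # t' # w) \<in> hurwitz_moves \<and> p' v = v \<and> t' v \<noteq> v"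
  proof (cases "q v = v")
    case True
    have "perm_conj t q v = q (t v)" by (simp add: perm_conj_def is_transp_inv[OF tq(2)] True)
    then have "perm_conj t q v \<noteq> v"
      using True Cons.prems(2) is_transp_involution[OF tq(2), of "t v"] by auto
    moreover have "(t # q # w, q # perm_conj t q # w) \<in> hurwitz_moves"
      using hurwitz_movesI[of _ _ _ _ "[]"] by simp
    ultimately show ?thesis using True by blast
  next
    case False
    note t = is_transp_moving[OF tq(1) Cons.prems(2)] and q = is_transp_moving[OF tq(2) False]
    have "t v \<noteq> q v"
    proof
      assume "t v = q v"
      with t have "t = Transposition.transpose (q v) v" by argo
      with q ne show False by argo
    qed
    then have "Transposition.transpose (q v) v (t v) = t v"
      by (rule transpose_apply_other[OF _ Cons.prems(2)])
    with q have "q (t v) = t v" by argo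
    then have "perm_conj q t v = v"
      by (simp add: perm_conj_def is_transp_inv[OF tq(1)] is_transp_involution[OF tq(1)])
    moreover have "(t # q # w, perm_conj q t # t # w) \<in> hurwitz_moves"
      using hurwitz_movesI[of _ _ _ _ "[]"] by simp
    ultimately show ?thesis using Cons.prems(2) by blast
  qed
  then obtain p' t' where m: "(t # q # w, p' # t' # w) \<in> hurwitz_moves" "p' v = v" "t' v \<noteq> v" by blast
  have "minimal_word (p' # t' # w)"
    by (rule minimal_word_hurwitz_moves[of _ _ 1, OF Cons.prems(1)]) (use m(1) in simp)
  then have "minimal_word (t' # w)" using minimal_word_factor[of "[p']" "t' # w" "[]"] by simp
  then obtain w' s where "(t' # w, w' @ [s]) \<in> hurwitz_moves ^^ length w" "s v \<noteq> v" "\<forall>s\<in>set w'. s v = v"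
    using Cons.IH[of t'] m(3) by blast
  moreover from this(1) have "(p' # t' # w, (p' # w') @ [s]) \<in> hurwitz_moves ^^ length w"
    using hurwitz_moves_pow_append[of "t' # w" "w' @ [s]" _ "[p']" "[]"] by simp
  moreover from this have "(t # q # w, (p' # w') @ [s]) \<in> hurwitz_moves ^^ length (q # w)"
    using relpow_Suc_I2[OF m(1)] by simp
  moreover have "\<forall>r\<in>set (p' # w'). r v = v" using m(2) \<open>\<forall>s\<in>set w'. s v = v\<close> by simp
  ultimately show ?case by blast
qed

text \<open>
  These words are forests built by attaching leaves. The point that is new in the last letter is moved by no other
  letter, so the last letter can be read off from the product of the word.
\<close>

definition growing :: "(nat \<Rightarrow> nat) list \<Rightarrow> bool" where
  "growing w \<longleftrightarrow> (\<forall>A t B. w = A @ t # B \<longrightarrow> (\<exists>v. t v \<noteq> v \<and> (\<forall>s\<in>set A. s v = v)))"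

text \<open>
  After the push, the product maps only the partner of \<open>v\<close> in the last letter to \<open>v\<close>, so the last letter
  is determined by the product and agrees with that of \<open>x\<close>. Pushing costs at most
  \<open>length x - 1\<close> moves, whence the binomial coefficient.
\<close>

lemma hurwitz_moves_to_growing:
  assumes "growing x" "\<forall>t\<in>set x. is_transp t" "minimal_word y"
    and "word_prod y = word_prod x" "length y = length x"
  shows "\<exists>k \<le> length x choose 2. (y, x) \<in> hurwitz_moves ^^ k"
  using assms
proof (induction x arbitrary: y rule: rev_induct)
  case Nil
  then show ?case by auto
next
  case (snoc t x)
  obtain v where v: "t v \<noteq> v" "\<forall>s\<in>set x. s v = v"
    using snoc.prems(1) unfolding growing_def by blast
  have t: "is_transp t" using snoc.prems(2) by auto
  have tr: "\<forall>t\<in>set y. is_transp t" using minimal_word_transp[OF snoc.prems(3)] by blast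
  have uv: "word_prod y (t v) = v"
    using snoc.prems(4) word_prod_fixes[OF v(2)] is_transp_involution[OF t] by simp
  have "\<exists>s\<in>set y. s v \<noteq> v"
    using word_prod_fixes[of y v] uv v(1) word_prod_bij[OF tr] by (metis bij_pointE)
  then obtain A s B where y: "y = A @ s # B" "s v \<noteq> v" "\<forall>r\<in>set A. r v = v"
    using split_list_first_prop[of y "\<lambda>s. s v \<noteq> v"] by blast
  then have "minimal_word (s # B)" using snoc.prems(3) minimal_word_factor[of A "s # B" "[]"] by simp
  then obtain B' t' where B': "(s # B, B' @ [t']) \<in> hurwitz_moves ^^ length B" "t' v \<noteq> v"
    "\<forall>s\<in>set B'. s v = v"
    using push_right y(2) by blast
  let ?y = "A @ B'"
  have step: "(y, ?y @ [t']) \<in> hurwitz_moves ^^ length B"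
    using hurwitz_moves_pow_append[OF B'(1), of A "[]"] y by simp
  have red: "minimal_word (?y @ [t'])" by (rule minimal_word_hurwitz_moves[OF snoc.prems(3) step])
  have inv: "length (?y @ [t']) = length y" "word_prod (?y @ [t']) = word_prod y"
    using hurwitz_moves_pow_invariants[OF step tr] by auto
  have t': "is_transp t'" using minimal_word_transp[OF red] by simp
  have "word_prod ?y v = v" by (rule word_prod_fixes) (use y(3) B'(3) in auto)
  then have "word_prod y (t' v) = v" using is_transp_involution[OF t'] by (simp flip: inv(2))
  then have "t' v = t v" using uv word_prod_bij[OF tr] by (metis bij_pointE)
  then have tt: "t' = t" using is_transp_moving t t' v(1) B'(2) by metis
  have "word_prod ?y \<circ> t = word_prod x \<circ> t" using inv(2) snoc.prems(4) tt
    by (metis comp_id word_prod_append word_prod_simps)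
  then have "word_prod ?y = word_prod x"
    using is_transp_comp_self[OF t] by (metis comp_assoc comp_id)
  moreover have "minimal_word ?y" using red minimal_word_factor[of "[]" ?y "[t']"] by simp
  moreover have "growing x" using snoc.prems(1) unfolding growing_def by simp
  moreover have "length ?y = length x" using inv(1) snoc.prems(5) by simp
  ultimately obtain k where k: "k \<le> length x choose 2" "(?y, x) \<in> hurwitz_moves ^^ k"
    using snoc.IH[of ?y] snoc.prems(2) by auto
  have "(?y @ [t], x @ [t]) \<in> hurwitz_moves ^^ k"
    using hurwitz_moves_pow_append[OF k(2), of "[]" "[t]"] by simp
  then have "(y, x @ [t]) \<in> hurwitz_moves ^^ (length B + k)"
    using step tt by (auto simp: relpow_add)
  moreover have "length B + k \<le> length (x @ [t]) choose 2"
    using k(1) y(1) snoc.prems(5) by (simp add: choose_two numeral_2_eq_2)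
  ultimately show ?case by blast
qed

section \<open>Inversions\<close>

text \<open>
  The entries may come from a partial order because thresholds below are initial segments of
  the natural numbers, compared by inclusion.
\<close>

fun inversions :: "'a::order list \<Rightarrow> nat" where
  "inversions [] = 0"
| "inversions (x # xs) = length (filter (\<lambda>y. y < x) xs) + inversions xs"

lemma inversions_adjacent_swap:
  "inversions (A @ b # a # B) \<le> Suc (inversions (A @ a # b # B))"
  by (induction A) auto

lemma inversions_decreasing:
  "sorted_wrt (>) xs \<Longrightarrow> inversions xs = length xs choose 2"
  by (induction xs) (simp_all add: numeral_2_eq_2 filter_id_conv[THEN iffD2])

lemma inversions_increasing:
  fixes xs :: "'a::order list"
  shows "sorted_wrt (<) xs \<Longrightarrow> inversions xs = 0"
proof (induction xs)
  case (Cons x xs)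
  then have "filter (\<lambda>y. y < x) xs = []" by (auto simp: filter_empty_conv dest: less_asym)
  with Cons show ?case by simp
qed simp

section \<open>Thresholds relative to a filtration\<close>

text \<open>
  Two letters are independent over \<open>F\<close> iff their span over \<open>F\<close> has rank two, and this depends only on the span.
  In matroid terms: if the second pair were dependent, a single element \<open>r\<close> would span what
  \<open>p\<close> and \<open>q\<close> span.
\<close>

lemma rank_two_exchange:
  assumes F: "\<forall>f\<in>F. is_transp f" and tr: "is_transp p" "is_transp q" "is_transp p'" "is_transp q'"
    and eq: "cl (F \<union> {p, q}) = cl (F \<union> {p', q'})"
    and indep: "p \<notin> cl F" "q \<notin> cl (insert p F)"
  shows "p' \<notin> cl F \<and> q' \<notin> cl (insert p' F)"
proof (rule ccontr)
  assume neg: "\<not> ?thesis"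
  \<comment> \<open>one of the two primed letters spans the other over \<open>F\<close>\<close>
  obtain r where r: "cl (insert q' (insert p' F)) = cl (insert r F)" "is_transp r"
  proof (cases "p' \<in> cl F")
    case True
    then have "p' \<in> cl (insert q' F)" using cl_mono[of F "insert q' F"] by blast
    then have "cl (insert p' (insert q' F)) = cl (insert q' F)" by (rule cl_insert_absorb)
    then show ?thesis using that[of q'] tr(4) by (metis insert_commute)
  next
    case False
    then have "q' \<in> cl (insert p' F)" using neg by blast
    then have "cl (insert q' (insert p' F)) = cl (insert p' F)" by (rule cl_insert_absorb)
    then show ?thesis using that[of p'] tr(3) by blast
  qed
  have "insert q' (insert p' F) = F \<union> {p', q'}" by auto
  with r eq have "cl (F \<union> {p, q}) = cl (insert r F)" by argo
  then have pq: "p \<in> cl (insert r F)" "q \<in> cl (insert r F)"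
    using cl_extensive[of "F \<union> {p, q}"] by auto
  have "r \<in> cl (insert p F)" by (rule cl_exchange[OF F tr(1) r(2) pq(1) indep(1)])
  then have "insert r F \<subseteq> cl (insert p F)" using cl_extensive[of "insert p F"] by auto
  then have "cl (insert r F) \<subseteq> cl (insert p F)" by (rule cl_subset)
  then show False using pq(2) indep(2) by blast
qed

text \<open>
  For monotone \<open>G\<close> each entry is an initial segment of the natural numbers, so it stands for the step at
  which the filtration absorbs the letter, or for infinity; working with the set itself avoids the conversion and
  the infinite case. For two maximal chains this is the Jordan-Hoelder permutation.
\<close>

fun thresholds :: "(nat \<Rightarrow> ('a \<Rightarrow> 'a) set) \<Rightarrow> ('a \<Rightarrow> 'a) set \<Rightarrow> ('a \<Rightarrow> 'a) list \<Rightarrow> nat set list" where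
  "thresholds G P [] = []"
| "thresholds G P (t # w) = {j. t \<notin> cl (P \<union> G j)} # thresholds G (insert t P) w"

lemma length_thresholds [simp]: "length (thresholds G P w) = length w"
  by (induction w arbitrary: P) auto

lemma nth_thresholds:
  "i < length w \<Longrightarrow> thresholds G P w ! i = {j. w ! i \<notin> cl (P \<union> set (take i w) \<union> G j)}"
proof (induction w arbitrary: P i)
  case (Cons t w)
  then show ?case by (cases i) auto
qed simp

lemma thresholds_append:
  "thresholds G P (u @ w) = thresholds G P u @ thresholds G (P \<union> set u) w"
  by (induction u arbitrary: P) auto

lemma thresholds_cong:
  "cl P = cl Q \<Longrightarrow> thresholds G P w = thresholds G Q w"
proof (induction w arbitrary: P Q)
  case (Cons t w)
  have "cl (insert t P) = cl (insert t Q)"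
    using cl_Un_cong[OF Cons.prems, of "{t}"] by simp
  from Cons.IH[OF this] show ?case by (simp add: cl_Un_cong[OF Cons.prems])
qed simp

text \<open>
  For each \<open>j\<close>, the number of the two thresholds that contain \<open>j\<close> is the rank of the pair over
  \<open>P \<union> G j\<close>, hence depends only on the span of the pair. So the union and the
  intersection of the two thresholds are determined, and two initial segments are determined, up to order,
  by their union and intersection.
\<close>

lemma thresholds_local_change:
  fixes P :: "('a \<Rightarrow> 'a) set"
  assumes G: "mono G" "\<forall>j. \<forall>f\<in>G j. is_transp f" and P: "\<forall>f\<in>P. is_transp f"
    and tr: "is_transp p" "is_transp q" "is_transp p'" "is_transp q'"
    and eq: "cl {p, q} = cl {p', q'}"
  shows "thresholds G P [p', q'] = thresholds G P [p, q] \<or>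
         thresholds G P [p', q'] = rev (thresholds G P [p, q])"
proof -
  define A B where "A p = {j. p \<notin> cl (P \<union> G j)}" and "B p q = {j. q \<notin> cl (insert p P \<union> G j)}" for p q
  \<comment> \<open>initial segments of the natural numbers are linearly ordered by inclusion\<close>
  have chain: "B p q \<subseteq> A p' \<or> A p' \<subseteq> B p q" for p q p'
  proof -
    have down: "i \<in> S" if "S = A p' \<or> S = B p q" "j \<in> S" "i \<le> j" for i j S
    proof -
      have "G i \<subseteq> G j" using that(3) G(1) by (simp add: monoD)
      then have "cl (H \<union> G i) \<subseteq> cl (H \<union> G j)" for H by (intro cl_mono) auto
      then show ?thesis using that(1,2) unfolding A_def B_def by blast
    qed
    show ?thesis using down[of "A p'"] down[of "B p q"] by (metis subsetI linear)
  qed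
  have eqj: "cl (P \<union> G j \<union> {p, q}) = cl (P \<union> G j \<union> {p', q'})" for j
    using cl_Un_cong[OF eq, of "P \<union> G j"] by (simp add: Un_commute)
  have tj: "\<forall>f\<in>P \<union> G j. is_transp f" for j using G(2) P by blast
  have un: "j \<in> A r \<union> B r s \<longleftrightarrow> \<not> cl (P \<union> G j \<union> {r, s}) = cl (P \<union> G j)" for r s j
  proof -
    have "r \<in> cl (P \<union> G j) \<and> s \<in> cl (insert r (P \<union> G j)) \<longleftrightarrow> cl (P \<union> G j \<union> {r, s}) = cl (P \<union> G j)"
      (is "?L \<longleftrightarrow> ?R")
    proof
      assume L: ?L
      then have "cl (insert s (insert r (P \<union> G j))) = cl (P \<union> G j)"
        using cl_insert_absorb[of s "insert r (P \<union> G j)"] cl_insert_absorb[of r "P \<union> G j"] by argo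
      then show ?R by (simp add: insert_commute)
    next
      assume R: ?R
      then show ?L using cl_extensive[of "P \<union> G j \<union> {r, s}"] cl_mono[of "P \<union> G j" "insert r (P \<union> G j)"] by auto
    qed
    then show ?thesis unfolding A_def B_def by auto
  qed
  have "A p \<union> B p q = A p' \<union> B p' q'"
    using un[of _ p q] un[of _ p' q'] eqj by blast
  moreover have "A p \<inter> B p q = A p' \<inter> B p' q'"
    using rank_two_exchange[OF tj tr eqj] rank_two_exchange[OF tj tr(3,4,1,2) eqj[symmetric]]
    unfolding A_def B_def by auto
  moreover have "B p q \<subseteq> A p \<or> A p \<subseteq> B p q" "B p' q' \<subseteq> A p' \<or> A p' \<subseteq> B p' q'" using chain by blast+
  ultimately have "A p' = A p \<and> B p' q' = B p q \<or> A p' = B p q \<and> B p' q' = A p" by blast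
  then show ?thesis unfolding A_def B_def by auto
qed

lemma hurwitz_moves_cl:
  assumes "is_transp p" "is_transp q" "p' = perm_conj q p \<and> q' = p \<or> p' = q \<and> q' = perm_conj p q"
  shows "cl {p, q} = cl {p', q'}"
proof -
  have *: "cl {r, s} = cl {s, perm_conj r s}" if "is_transp r" "is_transp s" for r s
  proof (rule cl_eq)
    have c: "perm_conj r s = s \<circ> (r \<circ> s)" using that by (simp add: perm_conj_def is_transp_inv comp_assoc)
    have r: "r = s \<circ> (perm_conj r s \<circ> s)"
      unfolding c using is_transp_involution[OF that(2)] by (simp add: fun_eq_iff)
    have g: "s \<in> cl {s, perm_conj r s}" "perm_conj r s \<in> cl {s, perm_conj r s}"
      using cl_extensive[of "{s, perm_conj r s}"] by auto
    then have "s \<circ> (perm_conj r s \<circ> s) \<in> cl {s, perm_conj r s}" by (intro cl_comp)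
    with g r show "{r, s} \<subseteq> cl {s, perm_conj r s}" by simp
    have g: "s \<in> cl {r, s}" "r \<in> cl {r, s}" using cl_extensive[of "{r, s}"] by auto
    then have "s \<circ> (r \<circ> s) \<in> cl {r, s}" by (intro cl_comp)
    with g show "{s, perm_conj r s} \<subseteq> cl {r, s}" unfolding c by simp
  qed
  show ?thesis using assms *[of p q] *[of q p] by (auto simp: insert_commute)
qed

text \<open>
  All letters other than the two involved see the same span of earlier letters and keep their thresholds.
\<close>

lemma inversions_hurwitz_move:
  assumes "(u, v) \<in> hurwitz_moves" "\<forall>t\<in>set u. is_transp t"
    and G: "mono G" "\<forall>j. \<forall>f\<in>G j. is_transp f"
  shows "inversions (thresholds G {} u) \<le> Suc (inversions (thresholds G {} v)) \<and>
         inversions (thresholds G {} v) \<le> Suc (inversions (thresholds G {} u))"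
proof -
  obtain A B p q p' q' where u: "u = A @ p # q # B" and v: "v = A @ p' # q' # B" and
    m: "p' = perm_conj q p \<and> q' = p \<or> p' = q \<and> q' = perm_conj p q"
    using assms(1) unfolding hurwitz_moves_def by blast
  have v': "\<forall>t\<in>set v. is_transp t" by (rule hurwitz_moves_invariants[OF assms(1,2)])
  have tr: "is_transp p" "is_transp q" "is_transp p'" "is_transp q'" "\<forall>t\<in>set A. is_transp t"
    using assms(2) v' u v by auto
  note eq = hurwitz_moves_cl[OF tr(1,2) m]
  have "cl (set A \<union> {p, q}) = cl (set A \<union> {p', q'})"
    using cl_Un_cong[OF eq, of "set A"] by (simp add: Un_commute)
  note B = thresholds_cong[OF this, of G B]
  define X Y where "X = thresholds G (set A) [p, q]" and "Y = thresholds G (set A) [p', q']"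
  define a b where "a = thresholds G {} A" and "b = thresholds G (set A \<union> {p, q}) B"
  have w: "w = A @ [r, s] @ B \<Longrightarrow> thresholds G {} w = a @ thresholds G (set A) [r, s] @ thresholds G (set A \<union> {r, s}) B"
    for w r s unfolding a_def by (simp only: thresholds_append) simp
  have lu: "thresholds G {} u = a @ X @ b" and lv: "thresholds G {} v = a @ Y @ b"
    using w[of u p q] w[of v p' q'] u v B unfolding X_def Y_def b_def by auto
  have "Y = X \<or> Y = rev X" unfolding X_def Y_def
    by (rule thresholds_local_change[OF G tr(5,1-4) eq])
  moreover have "length X = 2" unfolding X_def by simp
  then obtain x y where "X = [x, y]" by (auto simp: numeral_2_eq_2 length_Suc_conv)
  ultimately show ?thesis unfolding lu lv
    using inversions_adjacent_swap[of a y x b] inversions_adjacent_swap[of a x y b] by auto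
qed

section \<open>The half twist\<close>

text \<open>
  The Garside half twist of the braid group under the Hurwitz action: each letter in turn is
  moved to the right across all letters behind it.
\<close>

fun half_twist :: "(nat \<Rightarrow> nat) list \<Rightarrow> (nat \<Rightarrow> nat) list" where
  "half_twist [] = []"
| "half_twist (t # w) = half_twist w @ [perm_conj t (word_prod w)]"

lemma length_half_twist [simp]: "length (half_twist w) = length w"
  by (induction w) auto

lemma half_twist_transp: "\<forall>t\<in>set w. is_transp t \<Longrightarrow> \<forall>t\<in>set (half_twist w). is_transp t"
  by (induction w) (auto simp: is_transp_perm_conj word_prod_bij)

lemma word_prod_half_twist: "\<forall>t\<in>set w. is_transp t \<Longrightarrow> word_prod (half_twist w) = word_prod w"
proof (induction w)
  case (Cons t w)
  then have "bij (word_prod w)" by (simp add: word_prod_bij)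
  then have "word_prod w \<circ> perm_conj t (word_prod w) = t \<circ> word_prod w"
    unfolding perm_conj_def by (simp add: fun_eq_iff bij_is_surj surj_f_inv_f)
  with Cons show ?case by simp
qed simp

text \<open>
  The product of \<open>w\<close> moves points only within components of \<open>w\<close>, so conjugating an edge by it moves its
  ends within these components.
\<close>

lemma perm_conj_cl:
  assumes w: "\<forall>t\<in>set w. is_transp t" and t: "is_transp t"
  shows "cl (insert (perm_conj t (word_prod w)) (set w)) = cl (insert t (set w))"
proof -
  let ?p = "word_prod w"
  have p: "bij ?p" using w by (rule word_prod_bij)
  have "?p \<in> cl F \<and> inv ?p \<in> cl F" if "set w \<subseteq> F" for F
  proof -
    have "(x, ?p x) \<in> reach (set w)" for x using word_prod_in_cl[of w] unfolding cl_def by blast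
    then have "(inv ?p x, x) \<in> reach (set w)" for x using p by (metis bij_inv_eq_iff)
    then have "inv ?p \<in> cl (set w)" using reach_sym[OF w] unfolding cl_def by blast
    then show ?thesis using word_prod_in_cl[of w] cl_mono[OF that] by auto
  qed
  then have P: "?p \<in> cl (insert s (set w))" "inv ?p \<in> cl (insert s (set w))" for s by auto
  let ?s = "perm_conj t ?p"
  have "t \<in> cl (insert t (set w))" "?s \<in> cl (insert ?s (set w))"
    using cl_extensive[of "insert t (set w)"] cl_extensive[of "insert ?s (set w)"] by auto
  then have "inv ?p \<circ> t \<circ> ?p \<in> cl (insert t (set w))" "?p \<circ> ?s \<circ> inv ?p \<in> cl (insert ?s (set w))"
    using P by (intro cl_comp; simp)+
  moreover have "?p \<circ> ?s \<circ> inv ?p = t"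
    unfolding perm_conj_def using p by (simp add: fun_eq_iff bij_is_surj surj_f_inv_f)
  ultimately have "?s \<in> cl (insert t (set w))" "t \<in> cl (insert ?s (set w))"
    unfolding perm_conj_def by argo+
  moreover have "set w \<subseteq> cl (insert s (set w))" for s using cl_extensive[of "insert s (set w)"] by simp
  ultimately show ?thesis by (intro cl_eq) auto
qed

lemma cl_half_twist:
  "\<forall>t\<in>set w. is_transp t \<Longrightarrow> cl (set (half_twist w)) = cl (set w)"
proof (induction w)
  case (Cons t w)
  then have "cl (set (half_twist w) \<union> {perm_conj t (word_prod w)})
    = cl (set w \<union> {perm_conj t (word_prod w)})"
    by (intro cl_Un_cong) auto
  then show ?case using perm_conj_cl[of w t] Cons.prems by simp
qed simp

lemma cl_take_half_twist:
  assumes "\<forall>t\<in>set w. is_transp t" "j \<le> length w"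
  shows "cl (set (take j (half_twist w))) = cl (set (drop (length w - j) w))"
  using assms
proof (induction w)
  case (Cons t w)
  show ?case
  proof (cases "j \<le> length w")
    case True
    then show ?thesis using Cons by (simp add: Suc_diff_le)
  next
    case False
    then have j: "j = Suc (length w)" using Cons.prems by simp
    then show ?thesis using j Cons.prems cl_half_twist[of "t # w"] by simp
  qed
qed simp

text \<open>
  Independence in the graphic matroid, with repetitions excluded: no edge is spanned by the others,
  i.e. the word is a forest without repeated edges.
\<close>

definition independent :: "('a \<Rightarrow> 'a) list \<Rightarrow> bool" where
  "independent w \<longleftrightarrow> (\<forall>A t B. w = A @ t # B \<longrightarrow> t \<notin> cl (set A \<union> set B))"

lemma independent_nth:
  assumes "independent w" "i < length w" "F \<subseteq> set (take i w) \<union> set (drop (Suc i) w)"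
  shows "w ! i \<notin> cl F"
  using assms id_take_nth_drop[OF assms(2)] cl_mono[OF assms(3)] unfolding independent_def by blast

text \<open>
  Relative to its own prefixes, the letter at position \<open>i\<close> (counted from 0) is absorbed at \<open>j = i + 1\<close>, so its
  threshold is \<open>{..i}\<close>.
\<close>

lemma thresholds_self:
  assumes "independent z"
  shows "inversions (thresholds (\<lambda>j. set (take j z)) {} z) = 0"
proof (rule inversions_increasing)
  have "thresholds (\<lambda>j. set (take j z)) {} z ! i = {..i}" if "i < length z" for i
  proof -
    have "z ! i \<in> cl (set (take i z) \<union> set (take j z)) \<longleftrightarrow> i < j" for j
    proof
      assume "i < j"
      then have "z ! i \<in> set (take j z)" using that by (force simp: in_set_conv_nth)
      then show "z ! i \<in> cl (set (take i z) \<union> set (take j z))" using cl_extensive by blast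
    next
      assume *: "z ! i \<in> cl (set (take i z) \<union> set (take j z))"
      show "i < j"
      proof (rule ccontr)
        assume "\<not> i < j"
        then have "set (take j z) \<subseteq> set (take i z)" by (simp add: set_take_subset_set_take)
        then show False using independent_nth[OF assms that] * by blast
      qed
    qed
    then show ?thesis using that by (auto simp: nth_thresholds not_less)
  qed
  then show "sorted_wrt (<) (thresholds (\<lambda>j. set (take j z)) {} z)"
    by (auto simp: sorted_wrt_iff_nth_less)
qed

text \<open>
  The prefix of length \<open>j\<close> of the half twist spans the same as the last \<open>j\<close> letters of \<open>w\<close>. By
  independence these absorb the letter at position \<open>i\<close> as soon as they contain it, that is for
  \<open>j \<ge> length w - i\<close>.
\<close>

lemma thresholds_half_twist:
  assumes w: "\<forall>t\<in>set w. is_transp t" and "independent w"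
  shows "inversions (thresholds (\<lambda>j. set (take j (half_twist w))) {} w) = length w choose 2"
proof -
  let ?G = "\<lambda>j. set (take j (half_twist w))"
  have "thresholds ?G {} w ! i = {..<length w - i}" if i: "i < length w" for i
  proof -
    have "w ! i \<in> cl (set (take i w) \<union> ?G j) \<longleftrightarrow> length w - i \<le> j" for j
    proof -
      let ?D = "set (drop (length w - j) w)"
      have "cl (?G j) = cl ?D"
      proof (cases "j \<le> length w")
        case False
        then have "?G j = ?G (length w)" "?D = set (drop (length w - length w) w)" by auto
        then show ?thesis using cl_take_half_twist[OF w, of "length w"] by simp
      qed (simp add: cl_take_half_twist[OF w])
      then have eq: "cl (set (take i w) \<union> ?G j) = cl (set (take i w) \<union> ?D)"
        using cl_Un_cong[of "?G j" ?D "set (take i w)"] by (simp add: Un_commute)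
      show ?thesis
      proof
        assume "length w - i \<le> j"
        then have "length w - j \<le> i" by simp
        then have "w ! i \<in> ?D" using i
          by (auto simp: in_set_conv_nth intro!: exI[of _ "i - (length w - j)"])
        then show "w ! i \<in> cl (set (take i w) \<union> ?G j)" unfolding eq using cl_extensive by blast
      next
        assume *: "w ! i \<in> cl (set (take i w) \<union> ?G j)"
        show "length w - i \<le> j"
        proof (rule ccontr)
          assume "\<not> length w - i \<le> j"
          then have "?D \<subseteq> set (drop (Suc i) w)" by (intro set_drop_subset_set_drop) simp
          then show False using independent_nth[OF assms(2) i] * unfolding eq by blast
        qed
      qed
    qed
    then show ?thesis using i by (auto simp: nth_thresholds not_le)
  qed
  then have "sorted_wrt (>) (thresholds ?G {} w)"
    by (auto simp: sorted_wrt_iff_nth_less)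
  then show ?thesis using inversions_decreasing by fastforce
qed

section \<open>Factorizations of the long cycle\<close>

lemma cycle_of_list_upt:
  "k \<le> n \<Longrightarrow> cycle_of_list [k..<Suc n] j = (if j < k \<or> n < j then j else if j = n then k else Suc j)"
proof (induction "n - k" arbitrary: k j)
  case 0
  then show ?case by auto
next
  case (Suc d)
  then have "k < n" by simp
  then have "[k..<Suc n] = k # Suc k # [Suc (Suc k)..<Suc n]" by (simp add: upt_conv_Cons del: upt_Suc)
  then have c: "cycle_of_list [k..<Suc n] j = Transposition.transpose k (Suc k) (cycle_of_list [Suc k..<Suc n] j)"
    using \<open>k < n\<close> by (simp add: upt_conv_Cons[of "Suc k"] del: upt_Suc)
  have "cycle_of_list [Suc k..<Suc n] j = (if j < Suc k \<or> n < j then j else if j = n then Suc k else Suc j)"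
    by (rule Suc.hyps(1)) (use Suc.hyps(2) in auto)
  then show ?case unfolding c using \<open>k < n\<close> by (auto simp: Transposition.transpose_def)
qed

lemma transpositions_iff:
  "t \<in> transpositions n \<longleftrightarrow> is_transp t \<and> (\<forall>x. x \<notin> {1..n} \<longrightarrow> t x = x)"
proof
  assume "t \<in> transpositions n"
  then obtain a b where "t = Transposition.transpose a b" "a \<in> {1..n}" "b \<in> {1..n}" "a \<noteq> b"
    unfolding transpositions_def by blast
  then show "is_transp t \<and> (\<forall>x. x \<notin> {1..n} \<longrightarrow> t x = x)"
    unfolding is_transp_def by (metis transpose_apply_other)
next
  assume *: "is_transp t \<and> (\<forall>x. x \<notin> {1..n} \<longrightarrow> t x = x)"
  then obtain a b where t: "t = Transposition.transpose a b" "a \<noteq> b" unfolding is_transp_def by blast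
  then have "t a = b" "t b = a" by simp_all
  then have "a \<in> {1..n}" "b \<in> {1..n}" using * t(2) by metis+
  then show "t \<in> transpositions n" using t unfolding transpositions_def by blast
qed

lemma factorizations_transp: "w \<in> factorizations n \<Longrightarrow> \<forall>t\<in>set w. is_transp t"
  unfolding factorizations_def using transpositions_iff by blast

text \<open>
  A product of transpositions keeps each point in its component, and the long cycle takes each point to
  the next one.
\<close>

lemma factorization_connects:
  assumes "1 \<le> n" and tr: "\<forall>t\<in>set w. is_transp t" and "word_prod w = cycle_of_list [1..<Suc n]"
  shows "\<forall>u\<in>{1..n}. \<forall>v\<in>{1..n}. (u, v) \<in> reach (set w)"
proof -
  have "(j, word_prod w j) \<in> reach (set w)" for j
    using word_prod_in_cl[of w] unfolding cl_def by blast
  then have succ: "(j, Suc j) \<in> reach (set w)" if "1 \<le> j" "j < n" for j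
  proof -
    have "word_prod w j = Suc j" using that assms(3) cycle_of_list_upt[OF assms(1), of j] by auto
    then show ?thesis using \<open>\<And>j. (j, word_prod w j) \<in> reach (set w)\<close>[of j] by simp
  qed
  have one: "(1, v) \<in> reach (set w)" if "1 \<le> v" "v \<le> n" for v
    using that
  proof (induction v rule: dec_induct)
    case (step v)
    then have "(1, v) \<in> reach (set w)" "(v, Suc v) \<in> reach (set w)" using succ by auto
    then show ?case by (rule reach_trans)
  qed simp
  show ?thesis
  proof (intro ballI)
    fix u v assume "u \<in> {1..n}" "v \<in> {1..n}"
    then have "(1, u) \<in> reach (set w)" "(1, v) \<in> reach (set w)" using one by auto
    then show "(u, v) \<in> reach (set w)" using reach_sym[OF tr] reach_trans by fast
  qed
qed

lemma factorization_length:
  assumes "1 \<le> n" "\<forall>t\<in>set w. is_transp t" "word_prod w = cycle_of_list [1..<Suc n]"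
  shows "n - 1 \<le> length w"
  using connecting_word_length[OF assms(2) _ factorization_connects[OF assms]] by simp

lemma factorization_minimal:
  assumes "1 \<le> n" "w \<in> factorizations n"
  shows "minimal_word w"
proof -
  have "length w = n - 1" "word_prod w = cycle_of_list [1..<Suc n]"
    using assms(2) unfolding factorizations_def by auto
  then show ?thesis
    using factorization_length[OF assms(1)] factorizations_transp[OF assms(2)]
    unfolding minimal_word_def by simp
qed

text \<open>
  A redundant letter could be dropped, and \<open>n - 2\<close> edges do not connect \<open>n\<close> points.
\<close>

lemma factorization_independent:
  assumes "1 \<le> n" "w \<in> factorizations n"
  shows "independent w"
  unfolding independent_def
proof (intro allI impI notI)
  fix A t B
  assume w: "w = A @ t # B" and t: "t \<in> cl (set A \<union> set B)"
  have tr: "\<forall>t\<in>set w. is_transp t" by (rule factorizations_transp[OF assms(2)])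
  have len: "length w = n - 1" and prod: "word_prod w = cycle_of_list [1..<Suc n]"
    using assms(2) unfolding factorizations_def by auto
  have "set w \<subseteq> cl (set (A @ B))"
    using t cl_extensive[of "set (A @ B)"] unfolding w by auto
  then have "reach (set w) \<subseteq> reach (set (A @ B))" by (rule cl_least)
  then have "\<forall>u\<in>{1..n}. \<forall>v\<in>{1..n}. (u, v) \<in> reach (set (A @ B))"
    using factorization_connects[OF assms(1) tr prod] by blast
  moreover have "\<forall>t\<in>set (A @ B). is_transp t" using tr w by auto
  ultimately have "card {1..n} \<le> length (A @ B) + 1" by (intro connecting_word_length) auto
  then show False using len w by simp
qed

section \<open>Boundary caterpillars are growing\<close>

text \<open>
  Follow \<open>q\<close> through the product, from right to left. Without using \<open>t\<close> it cannot get from \<open>q\<close>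
  to \<open>r\<close>, as \<open>t\<close> is not spanned by the other letters. Hence it is still, or again, at \<open>q\<close> when \<open>t\<close> sends it to \<open>r\<close>,
  and the letters of \<open>A\<close> take \<open>r\<close> back to \<open>r\<close>. If some letter of \<open>A\<close> moved \<open>r\<close>, the rightmost such
  letter \<open>s\<close> would send \<open>r\<close> to \<open>s r\<close> and the letters before \<open>s\<close> would have to connect \<open>s r\<close> with \<open>r\<close>, so that
  \<open>s\<close> would be redundant.
\<close>

lemma successor_edge_comes_first:
  assumes "independent (A @ t # B)" and tr: "\<forall>s\<in>set (A @ t # B). is_transp s"
    and t: "t = Transposition.transpose q r" "q \<noteq> r" and prod: "word_prod (A @ t # B) q = r"
  shows "\<forall>s\<in>set A. s r = r"
proof (rule ccontr)
  have trAB: "\<forall>s\<in>set A. is_transp s" "\<forall>s\<in>set B. is_transp s" using tr by auto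
  have sep: "(q, r) \<notin> reach (set A \<union> set B)"
    using assms(1) transpose_in_cl_iff[of "set A \<union> set B" q r] trAB t
    unfolding independent_def by blast
  have orb: "(x, word_prod C x) \<in> reach (set C)" for x and C :: "(nat \<Rightarrow> nat) list"
    using word_prod_in_cl[of C] unfolding cl_def by blast
  let ?z = "word_prod B q"
  have "(q, ?z) \<in> reach (set A \<union> set B)" using orb[of q B] reach_mono[of "set B" "set A \<union> set B"] by blast
  moreover have "(t ?z, r) \<in> reach (set A \<union> set B)"
    using orb[of "t ?z" A] prod reach_mono[of "set A" "set A \<union> set B"] by auto
  ultimately have "?z \<noteq> r" "t ?z \<noteq> ?z" using sep reach_trans by metis+
  then have "?z = q" using t(1) by (metis transpose_apply_other)
  then have A: "word_prod A r = r" using prod t(1) by simp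
  assume "\<not> (\<forall>s\<in>set A. s r = r)"
  then obtain A1 s A2 where s: "A = A1 @ s # A2" "s r \<noteq> r" "\<forall>x\<in>set A2. x r = r"
    using split_list_last_prop[of A "\<lambda>s. s r \<noteq> r"] by blast
  have A1: "\<forall>x\<in>set A1. is_transp x" "is_transp s" using trAB s(1) by auto
  have "word_prod A1 (s r) = r" using A s(1) word_prod_fixes[OF s(3)] by simp
  then have "(s r, r) \<in> reach (set A1)" using orb[of "s r" A1] by simp
  then have "s \<in> cl (set A1)"
    using transpose_in_cl_iff[OF A1(1)] is_transp_moving[OF A1(2) s(2)] by metis
  then have "s \<in> cl (set A1 \<union> set (A2 @ t # B))" using cl_mono[of "set A1"] by blast
  moreover have "A @ t # B = A1 @ s # (A2 @ t # B)" using s(1) by simp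
  ultimately show False using assms(1) unfolding independent_def by blast
qed

lemma cycle_label_mod:
  assumes "1 \<le> n"
  shows "cycle_of_list [1..<Suc n] (label_mod n m) = label_mod n (Suc m)"
proof -
  have "m mod n < n" using assms by simp
  then show ?thesis
    unfolding cycle_of_list_upt[OF assms] label_mod_def mod_Suc by auto
qed

lemma word_edges_iff: "{a, b} \<in> word_edges w \<longleftrightarrow> a \<noteq> b \<and> Transposition.transpose a b \<in> set w"
proof
  assume "{a, b} \<in> word_edges w"
  then obtain c d where "{a, b} = {c, d}" "c \<noteq> d" "Transposition.transpose c d \<in> set w"
    unfolding word_edges_def by blast
  then show "a \<noteq> b \<and> Transposition.transpose a b \<in> set w"
    using transpose_commute[of c d] by (metis doubleton_eq_iff)
qed (unfold word_edges_def, blast)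

lemma not_leaf:
  assumes "Transposition.transpose a b \<in> set w" "a \<noteq> b" "s \<in> set w" "is_transp s"
    and "s a \<noteq> a" "s \<noteq> Transposition.transpose a b"
  shows "a \<notin> leaves V (word_edges w)"
proof
  obtain d where d: "s a = d" "d \<noteq> a" using assms(5) by blast
  have s: "s = Transposition.transpose a d"
    using is_transp_moving[OF assms(4,5)] transpose_commute[of a d] unfolding d(1) by argo
  assume "a \<in> leaves V (word_edges w)"
  then have "card {e \<in> word_edges w. a \<in> e} = 1" unfolding leaves_def by blast
  then obtain e where e: "{e \<in> word_edges w. a \<in> e} = {e}" by (rule card_1_singletonE)
  have "{a, b} \<in> word_edges w" "{a, d} \<in> word_edges w"
    unfolding word_edges_iff using assms(1-3) d(2) s by auto
  then have "{a, b} \<in> {e \<in> word_edges w. a \<in> e}" "{a, d} \<in> {e \<in> word_edges w. a \<in> e}" by simp_all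
  then have "{a, b} = {a, d}" unfolding e by simp
  then have "b = d" using assms(2) d(2) by (metis doubleton_eq_iff)
  then show False using s assms(6) by simp
qed

text \<open>
  The spine runs along the boundary of the circle, so each of its edges joins a point to its image under the
  long cycle, and \<open>successor_edge_comes_first\<close> applies.
\<close>

lemma boundary_caterpillar_growing:
  assumes "1 \<le> n" "w \<in> factorizations n" "boundary_caterpillar n (word_edges w)"
  shows "growing w"
  unfolding growing_def
proof (intro allI impI, rule ccontr)
  fix A t B
  assume w: "w = A @ t # B" and neg: "\<nexists>v. t v \<noteq> v \<and> (\<forall>s\<in>set A. s v = v)"
  have len: "length w = n - 1" and prod: "word_prod w = cycle_of_list [1..<Suc n]"
    and tn: "set w \<subseteq> transpositions n"
    using assms(2) unfolding factorizations_def by auto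
  have tr: "\<forall>t\<in>set w. is_transp t" by (rule factorizations_transp[OF assms(2)])
  have ind: "independent w" by (rule factorization_independent[OF assms(1,2)])
  have "t \<in> transpositions n" using tn w by auto
  then obtain a b where t: "t = Transposition.transpose a b" "a \<noteq> b" "a \<in> {1..n}" "b \<in> {1..n}"
    unfolding transpositions_def by blast
  have tA: "t \<notin> set A"
    using ind cl_extensive[of "set A \<union> set B"] unfolding independent_def w by blast
  have spine: "v \<in> spine_verts {1..n} (word_edges w)" if "v \<in> {1..n}" "t = Transposition.transpose v u" "v \<noteq> u" for u v
  proof -
    have "t v \<noteq> v" using that by simp
    then obtain s where "s \<in> set A" "s v \<noteq> v" using neg by blast
    then have "v \<notin> leaves {1..n} (word_edges w)"
      using not_leaf[of v u w s "{1..n}"] tA tr that w by auto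
    then show ?thesis using that(1) unfolding spine_verts_def by blast
  qed
  have "t = Transposition.transpose b a" using t(1) by (simp add: transpose_commute)
  then have "{a, b} \<subseteq> spine_verts {1..n} (word_edges w)"
    using spine[OF t(3,1,2)] spine[OF t(4) _ t(2)[symmetric]] by simp
  moreover have "{a, b} \<in> word_edges w" using t(1,2) w by (simp add: word_edges_iff)
  ultimately have "{a, b} \<in> spine_edges {1..n} (word_edges w)" unfolding spine_edges_def by blast
  moreover have "t a \<noteq> a" using t(1,2) by simp
  then have "A \<noteq> []" using neg by force
  then have "\<not> n \<le> 2" using len w by (cases A) auto
  then obtain i k where "is_path_graph (spine_verts {1..n} (word_edges w)) (spine_edges {1..n} (word_edges w))
                         (map (\<lambda>j. label_mod n (i + j)) [0..<Suc k])"
    using assms(3) unfolding boundary_caterpillar_def by blast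
  ultimately obtain j where j: "Suc j < Suc k" "{a, b} = {map (\<lambda>j. label_mod n (i + j)) [0..<Suc k] ! j,
      map (\<lambda>j. label_mod n (i + j)) [0..<Suc k] ! Suc j}"
    unfolding is_path_graph_def by auto
  define q r where "q = label_mod n (i + j)" and "r = label_mod n (Suc (i + j))"
  have ab: "{a, b} = {q, r}" using j unfolding q_def r_def by (simp del: upt_Suc)
  then have tq: "t = Transposition.transpose q r" "q \<noteq> r"
    using t(1,2) transpose_commute[of a b] by (metis doubleton_eq_iff)+
  have "word_prod w q = r" unfolding prod q_def r_def by (rule cycle_label_mod[OF assms(1)])
  then have "\<forall>s\<in>set A. s r = r"
    using successor_edge_comes_first[of A t B q r] ind tr tq unfolding w by blast
  moreover have "t r \<noteq> r" using tq by simp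
  ultimately show False using neg by blast
qed

section \<open>Distances in the Hurwitz graph\<close>

lemma hurwitz_moves_factorizations:
  assumes "(u, v) \<in> hurwitz_moves" "u \<in> factorizations n"
  shows "v \<in> factorizations n" "(u, v) \<in> graph_adj (hurwitz_edges n)"
proof -
  obtain A B p q p' q' where u: "u = A @ p # q # B" and v: "v = A @ p' # q' # B" and
    m: "p' = perm_conj q p \<and> q' = p \<or> p' = q \<and> q' = perm_conj p q"
    using assms(1) unfolding hurwitz_moves_def by blast
  have tr: "\<forall>t\<in>set u. is_transp t" by (rule factorizations_transp[OF assms(2)])
  note inv = hurwitz_moves_invariants[OF assms(1) tr]
  have len: "length u = n - 1" and tn: "set u \<subseteq> transpositions n"
    using assms(2) unfolding factorizations_def by auto
  have conj: "perm_conj r s x = x" if "is_transp s" "r x = x" "s x = x" for r s :: "nat \<Rightarrow> nat" and x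
    using that by (simp add: perm_conj_def is_transp_inv)
  have "t \<in> transpositions n" if "t \<in> set v" for t
  proof -
    have *: "s x = x" if "s \<in> set u" "x \<notin> {1..n}" for s x
      using that tn transpositions_iff by blast
    have "t x = x" if "x \<notin> {1..n}" for x
    proof -
      have "t \<in> set u \<or> t = perm_conj q p \<or> t = perm_conj p q" using \<open>t \<in> set v\<close> m u v by auto
      moreover have "p x = x" "q x = x" "is_transp p" "is_transp q" using *[OF _ that] tr u by auto
      ultimately show ?thesis using *[OF _ that] conj by blast
    qed
    then show ?thesis using inv(3) that transpositions_iff by blast
  qed
  then show vF: "v \<in> factorizations n" using inv(1,2) assms(2) unfolding factorizations_def by auto
  have i: "Suc (length A) \<in> {1..n - 2}" using len u by auto
  have "v = hurwitz_R (Suc (length A)) u \<or> v = hurwitz_L (Suc (length A)) u"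
    using m unfolding u v hurwitz_R_def hurwitz_L_def
    by (auto simp: list_update_append nth_append)
  then show "(u, v) \<in> graph_adj (hurwitz_edges n)"
    using vF assms(2) i unfolding graph_adj_def hurwitz_edges_def by blast
qed

lemma hurwitz_moves_pow_graph_adj:
  assumes "(u, v) \<in> hurwitz_moves ^^ k" "u \<in> factorizations n"
  shows "v \<in> factorizations n \<and> (v, u) \<in> graph_adj (hurwitz_edges n) ^^ k"
  using assms
proof (induction k arbitrary: v)
  case (Suc k)
  obtain y where y: "(u, y) \<in> hurwitz_moves ^^ k" "(y, v) \<in> hurwitz_moves"
    using Suc.prems(1) by (rule relpow_Suc_E)
  then have IH: "y \<in> factorizations n" "(y, u) \<in> graph_adj (hurwitz_edges n) ^^ k"
    using Suc by auto
  note v = hurwitz_moves_factorizations[OF y(2) IH(1)]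
  have "(v, y) \<in> graph_adj (hurwitz_edges n)"
    using v(2) unfolding graph_adj_def by (simp add: insert_commute)
  then show ?case using v(1) relpow_Suc_I2[OF _ IH(2)] by blast
qed simp

lemma graph_adj_hurwitz_moves:
  assumes "(u, v) \<in> graph_adj (hurwitz_edges n)"
  shows "u \<in> factorizations n" "(u, v) \<in> hurwitz_moves \<or> (v, u) \<in> hurwitz_moves"
        "v \<in> factorizations n"
proof -
  have move: "(x, hurwitz_R i x) \<in> hurwitz_moves \<and> (x, hurwitz_L i x) \<in> hurwitz_moves"
    if "x \<in> factorizations n" "i \<in> {1..n - 2}" for i x
  proof -
    have len: "length x = n - 1" using that(1) unfolding factorizations_def by simp
    \<comment> \<open>letters are numbered from 1, list positions from 0\<close>
    define A where "A = take (i - 1) x"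
    have "x = A @ x ! (i - 1) # x ! i # drop (Suc i) x"
      unfolding A_def using that(2) len id_take_nth_drop[of "i - 1" x] Cons_nth_drop_Suc[of i x] by auto
    then obtain p q B where x: "x = A @ p # q # B" by blast
    have "i = Suc (length A)" unfolding A_def using that(2) len by auto
    then have "hurwitz_R i x = A @ perm_conj q p # p # B" "hurwitz_L i x = A @ q # perm_conj p q # B"
      unfolding x hurwitz_R_def hurwitz_L_def by (auto simp: list_update_append nth_append)
    then show ?thesis using hurwitz_movesI x by auto
  qed
  obtain x y where "{u, v} = {x, y}" "x \<in> factorizations n" "y \<in> factorizations n"
    "(x, y) \<in> hurwitz_moves"
    using assms move unfolding graph_adj_def hurwitz_edges_def by blast
  then show "u \<in> factorizations n" "(u, v) \<in> hurwitz_moves \<or> (v, u) \<in> hurwitz_moves"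
        "v \<in> factorizations n" by (auto simp: doubleton_eq_iff)
qed

lemma half_twist_factorization:
  assumes "u \<in> factorizations n"
  shows "half_twist u \<in> factorizations n"
proof -
  have tr: "\<forall>t\<in>set u. is_transp t" by (rule factorizations_transp[OF assms])
  have "\<forall>t\<in>set (half_twist w). t x = x" if "\<forall>t\<in>set w. is_transp t \<and> t x = x" for x w
    using that
  proof (induction w)
    case (Cons t w)
    have "word_prod w x = x" using Cons.prems by (intro word_prod_fixes) auto
    moreover have "bij (word_prod w)" using Cons.prems by (intro word_prod_bij) auto
    ultimately have "inv (word_prod w) x = x" by (metis bij_inv_eq_iff)
    then have "perm_conj t (word_prod w) x = x"
      using \<open>word_prod w x = x\<close> Cons.prems by (simp add: perm_conj_def)
    then show ?case using Cons by simp
  qed simp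
  moreover have "\<forall>t\<in>set u. is_transp t \<and> t x = x" if "x \<notin> {1..n}" for x
    using assms that transpositions_iff unfolding factorizations_def by blast
  ultimately have "set (half_twist u) \<subseteq> transpositions n"
    using half_twist_transp[OF tr] transpositions_iff by blast
  then show ?thesis using word_prod_half_twist[OF tr] assms unfolding factorizations_def by simp
qed

text \<open>
  The number of inversions, relative to the prefixes of the half twist, has to drop from
  \<open>n - 1 choose 2\<close> to zero and changes by at most one along each edge.
\<close>

lemma half_twist_far:
  assumes "1 \<le> n" "u \<in> factorizations n" "(u, half_twist u) \<in> graph_adj (hurwitz_edges n) ^^ k"
  shows "n - 1 choose 2 \<le> k"
proof -
  define G where "G j = set (take j (half_twist u))" for j
  have tr: "\<forall>t\<in>set u. is_transp t" by (rule factorizations_transp[OF assms(2)])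
  have G: "mono G"
    unfolding G_def by (intro monoI set_take_subset_set_take)
  have Gt: "\<forall>j. \<forall>f\<in>G j. is_transp f"
    unfolding G_def using half_twist_transp[OF tr] by (blast dest: in_set_takeD)
  have len: "length u = n - 1" using assms(2) unfolding factorizations_def by simp
  have "inversions (thresholds G {} u) \<le> inversions (thresholds G {} v) + k"
    if "(u, v) \<in> graph_adj (hurwitz_edges n) ^^ k" for v k
    using that
  proof (induction k arbitrary: v)
    case (Suc k)
    obtain y where y: "(u, y) \<in> graph_adj (hurwitz_edges n) ^^ k" "(y, v) \<in> graph_adj (hurwitz_edges n)"
      using Suc.prems by (rule relpow_Suc_E)
    note adj = graph_adj_hurwitz_moves[OF y(2)]
    have "inversions (thresholds G {} y) \<le> Suc (inversions (thresholds G {} v))"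
      using adj(2) inversions_hurwitz_move[OF _ factorizations_transp[OF adj(1)] G Gt]
        inversions_hurwitz_move[OF _ factorizations_transp[OF adj(3)] G Gt] by blast
    then show ?case using Suc.IH[OF y(1)] by simp
  qed simp
  from this[OF assms(3)] show ?thesis
    using thresholds_self[OF factorization_independent[OF assms(1) half_twist_factorization[OF assms(2)]]]
      thresholds_half_twist[OF tr factorization_independent[OF assms(1,2)]] len
    unfolding G_def by simp
qed

lemma finite_factorizations: "finite (factorizations n)"
proof -
  have "transpositions n \<subseteq> (\<lambda>(a, b). Transposition.transpose a b) ` ({1..n} \<times> {1..n})"
    unfolding transpositions_def by auto
  then have "finite (transpositions n)" by (rule finite_subset) simp
  then have "finite {w. set w \<subseteq> transpositions n \<and> length w = n - 1}" by (rule finite_lists_length_eq)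
  then show ?thesis by (rule rev_finite_subset) (auto simp: factorizations_def)
qed

text \<open>
  A bound \<open>N\<close> that is an upper bound for one eccentricity and a lower bound for all of them is the
  radius.
\<close>

lemma central_vertexI:
  assumes "finite V" "w \<in> V" and sym: "sym (graph_adj E)"
    and near: "\<And>u. u \<in> V \<Longrightarrow> \<exists>k\<le>N. (w, u) \<in> graph_adj E ^^ k"
    and far: "\<And>v. v \<in> V \<Longrightarrow> \<exists>u\<in>V. \<forall>k. (v, u) \<in> graph_adj E ^^ k \<longrightarrow> N \<le> k"
  shows "central_vertex V E w"
proof -
  have reach_w: "(w, u) \<in> (graph_adj E)\<^sup>*" if "u \<in> V" for u
    using near[OF that] relpow_imp_rtrancl by blast
  then have "graph_connected V E"
    unfolding graph_connected_def using assms(2) sym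
    by (metis empty_iff rtrancl_trans symD sym_rtrancl)
  have "graph_dist E w u \<le> enat N" if u: "u \<in> V" for u
  proof -
    obtain k where k: "k \<le> N" "(w, u) \<in> graph_adj E ^^ k" using near[OF u] by blast
    then have "graph_dist E w u \<le> enat k" unfolding graph_dist_def by (intro INF_lower) simp
    then show ?thesis using k(1) by (meson enat_ord_simps(1) order.trans)
  qed
  then have le: "eccentricity V E w \<le> enat N" unfolding eccentricity_def by (rule SUP_least)
  have ge: "enat N \<le> eccentricity V E v" if "v \<in> V" for v
  proof -
    obtain u where u: "u \<in> V" "\<forall>k. (v, u) \<in> graph_adj E ^^ k \<longrightarrow> N \<le> k" using far[OF \<open>v \<in> V\<close>] by blast
    then have "enat N \<le> graph_dist E v u" unfolding graph_dist_def by (intro INF_greatest) simp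
    then show ?thesis unfolding eccentricity_def using u(1) by (meson SUP_upper order.trans)
  qed
  have "graph_radius V E \<le> eccentricity V E w" unfolding graph_radius_def using assms(2) by (rule INF_lower)
  moreover have "enat N \<le> graph_radius V E" unfolding graph_radius_def using ge by (rule INF_greatest)
  ultimately have "eccentricity V E w = graph_radius V E" using le by order
  then show ?thesis
    using assms(1,2) \<open>graph_connected V E\<close> unfolding central_vertex_def by blast
qed

theorem theorem4p1p2:
  fixes n :: nat and w :: "(nat \<Rightarrow> nat) list"
  assumes "n \<ge> 1"
    and "w \<in> factorizations n"
    and "boundary_caterpillar n (word_edges w)"
  shows "central_vertex (factorizations n) (hurwitz_edges n) w"
proof (rule central_vertexI[where N = "n - 1 choose 2"])
  show "finite (factorizations n)" by (rule finite_factorizations)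
  show "w \<in> factorizations n" by (rule assms(2))
  show "sym (graph_adj (hurwitz_edges n))"
    by (rule symI) (simp add: graph_adj_def insert_commute)
next
  fix u
  assume u: "u \<in> factorizations n"
  have "word_prod u = word_prod w" "length u = length w" "length w = n - 1"
    using u assms(2) unfolding factorizations_def by auto
  then obtain k where "k \<le> n - 1 choose 2" "(u, w) \<in> hurwitz_moves ^^ k"
    using hurwitz_moves_to_growing[OF boundary_caterpillar_growing[OF assms]
        factorizations_transp[OF assms(2)] factorization_minimal[OF assms(1) u]] by metis
  then show "\<exists>k\<le>n - 1 choose 2. (w, u) \<in> graph_adj (hurwitz_edges n) ^^ k"
    using hurwitz_moves_pow_graph_adj[OF _ u] by blast
next
  fix v
  assume v: "v \<in> factorizations n"
  then show "\<exists>u\<in>factorizations n. \<forall>k. (v, u) \<in> graph_adj (hurwitz_edges n) ^^ k \<longrightarrow> n - 1 choose 2 \<le> k"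
    using half_twist_factorization[OF v] half_twist_far[OF assms(1) v] by blast
qed

end
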